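(* Let $F$ be the skew product over the three-legged horseshoe with fiber maps $f_0,f_1,f_2$ described in the context, satisfying (F0), (F1), (F2), (F01) and (F012). Let $\Lambda$ be the maximal invariant set and $\mathcal M_{\rm e}(\Lambda)$ the set of ergodic $F$-invariant Borel probability measures on $\Lambda$. Let $\widetilde\beta=\exp\sup\{\overline\chi(p,\xi):(p,\xi)\notin\mathcal E\}$ be as in the context. Then $$\{\chi_c(\mu):\mu\in\mathcal M_{\rm e}(\Lambda)\}\subset[\log\lambda_0,\log\widetilde\beta]\cup[\log\beta_{02}^-,\log\beta_{02}^+].$$
   Context: **Base.** $\Phi$ is a diffeomorphism of $\mathbb R^2$ having a horseshoe $\Gamma\subset\widehat{\mathbf C}=[0,1]^2$ and a conjugation $\varpi:\Gamma\to\Sigma_3=\{0,1,2\}^{\mathbb Z}$ with $\varpi\circ\Phi=\sigma\circ\varpi$, $\sigma$ the full shift. $\widehat{\mathbf C}_0,\widehat{\mathbf C}_1,\widehat{\mathbf C}_2$ are the three naturally associated sub-rectangles of $\widehat{\mathbf C}$ ($X\in\Gamma$ lies in $\widehat{\mathbf C}_i$ iff the $0$-th symbol of $\varpi(X)$ is $i$). $\Phi$ is affine on each $\widehat{\mathbf C}_i$, contracting the first coordinate direction and expanding the second. **Skew product.** $\mathbf C=[0,1]^3$ and $F(\widehat x,x)=(\Phi(\widehat x),f_i(x))$ if $(\widehat x,x)\in\widehat{\mathbf C}_i\times[0,1]$, where $f_0,f_1,f_2:[0,1]\to[0,1]$ are $C^1$ injective maps. The rate of expansion (contraction) of the horseshoe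 is stronger than any expansion (contraction) of $f_0,f_1,f_2$, so that the $DF$-invariant splitting $E^{ss}\oplus E^c\oplus E^{uu}$ into the first, third and second coordinate directions is dominated. $\Lambda=\bigcap_{i\in\mathbb Z}F^i(\mathbf C)$. **Fiber maps.** (F0) $f_0$ is increasing and has exactly two hyperbolic fixed points, $0$ (repelling) and $1$ (attracting); $\beta_0=f_0'(0)>1$, $\lambda_0=f_0'(1)\in(0,1)$, and $\lambda_0\le f_0'(x)$ for all $x\in[0,1]$. (F1) $f_1(x)=\gamma(1-x)$ is an affine contraction, with $\gamma\ge\lambda_0$ (and $\gamma<1$). (F2) $f_2$ is increasing and has two hyperbolic fixed points, $0$ (repelling) and a point $p_2\in(0,1)$ (attracting); $\beta_2=f_2'(0)>1$. (F01) $f_0'$ is decreasing on $[0,1]$ and $\gamma\,\frac{\lambda_0^3(1-\lambda_0)}{1-\beta_0^{-1}}>1$. Put $\beta_{02}^-=\min\{\beta_0,\beta_2\}$, $\beta_{02}^+=\max\{\beta_0,\beta_2\}$. (F012) $f_0'(x),f_2'(x)\le\beta_{02}^+$ for all $x\in[0,1]$. There is an interval $H=[0,\delta]$ such that $H$ and $H'=f_1^{-1}(H)$ satisfy $f_1(H)\cap H=\emptyset$, $f_1(H')\cap H'=\emptyset$, $f_1([0,1])\cap H'=\emptyset$, $f_2([0,1])\cap H'=\emptyset$. Moreover $\beta'=\max\{f_0'(x),f_2'(x):x\notin H\}<\beta_{02}^-$; $\beta_H=\min\{f_0'(x),f_2'(x):x\in H\}<\beta_{02}^-$; $\lambda'=\max\{f_0'(x):x\in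 H'\}<1$; $$|\log\lambda_0|\frac{\log\beta_{02}^+}{\log\beta_H}-|\log\lambda'|+\tfrac23\log\beta_{02}^+<\tfrac34\log\beta';$$ and, with $L\ge1$ satisfying $L>4\frac{|\log\lambda_0|\log\beta_{02}^+}{\log\beta_H\log\beta'}$, one has $\frac{\log((\beta_{02}^+)^L\gamma)}{L+1}<\log\beta'$. **IFS exponents.** $f_{[\xi_0\ldots\xi_m]}=f_{\xi_m}\circ\cdots\circ f_{\xi_0}$. For $p\in[0,1]$ and $\xi=(\ldots\xi_{-1}.\xi_0\xi_1\ldots)\in\Sigma_3$, $\overline\chi(p,\xi)=\limsup_n\frac1n\log|(f_{[\xi_0\ldots\xi_{n-1}]})'(p)|$. (A sequence $\xi$ is called admissible for $x$ if $(f_{\xi_{-1}}\circ\cdots\circ f_{\xi_{-m}})^{-1}(x)$ is defined for all $m\ge1$. The convention is that writing $(x,\xi)$ means that $\xi$ is admissible for $x$; but since exponents depend only on $\xi_0\xi_1\ldots$, the admissibility hypothesis is disregarded when exponents of pairs are considered.) The exceptional set $\mathcal E$ consists of the pairs $(0,\xi)$ with $\xi\in\{0,2\}^{\mathbb Z}$; the pairs $(1,\xi)$ with $\xi=(0^{-\mathbb N}.0^k\,1\,\xi^+)$; and the pairs $(0,\xi)$ with $\xi=(0^{-\mathbb N}1\,\eta.\xi^+)$, where $k\ge0$, $\eta\in\{0,2\}^k$, $\xi^+\in\{0,2\}^{\mathbb N}$ ($0^{-\mathbb N}$ is the left-infinite sequence of zeros; the dot precedes position $0$). **Central exponent.** $\chi_c(\mu)=\int\log\lVert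 dF|_{E^c}\rVert\,d\mu$.
   Formalization: The formal theorem additionally assumes λ_0 ≤ f_2'(x) for all x in [0,1]; without it the claim fails, since the Dirac measure at the fixed point over p_2 has exponent log f_2'(p_2), which the listed conditions allow to be below log λ_0. *)

theory Defs
  imports "HOL-Probability.Probability"
begin

section \<open>Maximal invariant sets\<close>

text \<open>
  The intersection over all integers k of the sets F^k(C), for a map F that is only regarded as
  defined on the domain D: the n-th forward image of C consists of the end points of orbits of
  length n starting in C with all steps taken at points of D, and the n-th preimage of the points
  of D from which n steps can be made, ending in C.
\<close>

definition max_invariant :: "'a set \<Rightarrow> ('a \<Rightarrow> 'a) \<Rightarrow> 'a set \<Rightarrow> 'a set" where
  "max_invariant D F C =
     (\<Inter>n::nat. ((\<lambda>A. F ` (A \<inter> D)) ^^ n) C) \<inter>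
     (\<Inter>n::nat. ((\<lambda>A. {X \<in> D. F X \<in> A}) ^^ n) C)"


section \<open>The three-legged horseshoe\<close>

text \<open>Bi-infinite sequences over the symbols 0, 1, 2. Topological statements about this set refer
  to the product topology on \<^typ>\<open>int \<Rightarrow> nat\<close>.\<close>

definition Sigma3 :: "(int \<Rightarrow> nat) set" where
  "Sigma3 = {\<xi>. \<forall>k. \<xi> k \<in> {0, 1, 2}}"

definition shift :: "(int \<Rightarrow> nat) \<Rightarrow> (int \<Rightarrow> nat)" where
  "shift \<xi> = (\<lambda>k. \<xi> (k + 1))"

definition C1_map :: "('a::real_normed_vector \<Rightarrow> 'a) \<Rightarrow> bool" where
  "C1_map g \<longleftrightarrow>
     (\<exists>g'. continuous_on UNIV g' \<and> (\<forall>x. (g has_derivative blinfun_apply (g' x)) (at x)))"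

definition C1_diffeomorphism :: "('a::real_normed_vector \<Rightarrow> 'a) \<Rightarrow> bool" where
  "C1_diffeomorphism \<Phi> \<longleftrightarrow> bij \<Phi> \<and> C1_map \<Phi> \<and> C1_map (inv \<Phi>)"

definition is_rectangle :: "(real \<times> real) set \<Rightarrow> bool" where
  "is_rectangle S \<longleftrightarrow> (\<exists>a b c d. a < b \<and> c < d \<and> S = {a..b} \<times> {c..d})"

text \<open>
  \<open>R i\<close> is the rectangle of the symbol \<open>i\<close>; on it \<open>\<Phi>\<close> is affine with diagonal linear part, with
  entry \<open>s i\<close> in the first (contracting) and \<open>u i\<close> in the second (expanding) direction.
\<close>

definition three_legged_horseshoe ::
  "(real \<times> real \<Rightarrow> real \<times> real) \<Rightarrow> (real \<times> real) set \<Rightarrow> (real \<times> real \<Rightarrow> int \<Rightarrow> nat) \<Rightarrow>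
   (nat \<Rightarrow> (real \<times> real) set) \<Rightarrow> (nat \<Rightarrow> real) \<Rightarrow> (nat \<Rightarrow> real) \<Rightarrow> bool" where
  "three_legged_horseshoe \<Phi> \<Gamma> \<omega> R s u \<longleftrightarrow>
     C1_diffeomorphism \<Phi> \<and>
     \<Gamma> = max_invariant UNIV \<Phi> ({0..1} \<times> {0..1}) \<and>
     (\<exists>\<omega>'. homeomorphism \<Gamma> Sigma3 \<omega> \<omega>') \<and>
     (\<forall>X\<in>\<Gamma>. \<omega> (\<Phi> X) = shift (\<omega> X)) \<and>
     (\<forall>i\<in>{0, 1, 2}. is_rectangle (R i) \<and> R i \<subseteq> {0..1} \<times> {0..1}) \<and>
     (\<forall>i\<in>{0, 1, 2}. \<forall>j\<in>{0, 1, 2}. i \<noteq> j \<longrightarrow> R i \<inter> R j = {}) \<and>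
     (\<forall>i\<in>{0, 1, 2}. \<forall>X\<in>\<Gamma>. X \<in> R i \<longleftrightarrow> \<omega> X 0 = i) \<and>
     (\<forall>i\<in>{0, 1, 2}. \<bar>s i\<bar> < 1 \<and> 1 < \<bar>u i\<bar> \<and>
        (\<exists>a b. \<forall>x y. (x, y) \<in> R i \<longrightarrow> \<Phi> (x, y) = (s i * x + a, u i * y + b)))"


section \<open>Fiber maps\<close>

text \<open>The derivative of a map of the unit interval; it is one-sided at the end points.\<close>

definition fderiv :: "(real \<Rightarrow> real) \<Rightarrow> real \<Rightarrow> real" where
  "fderiv g x = vector_derivative g (at x within {0..1})"

definition C1_unit_interval :: "(real \<Rightarrow> real) \<Rightarrow> bool" where
  "C1_unit_interval g \<longleftrightarrow>
     (\<exists>g'. continuous_on {0..1} g' \<and>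
           (\<forall>x\<in>{0..1}. (g has_real_derivative g' x) (at x within {0..1})))"

definition fiber_maps :: "(nat \<Rightarrow> real \<Rightarrow> real) \<Rightarrow> bool" where
  "fiber_maps f \<longleftrightarrow>
     (\<forall>i\<in>{0, 1, 2}. f i ` {0..1} \<subseteq> {0..1} \<and> inj_on (f i) {0..1} \<and> C1_unit_interval (f i))"

text \<open>The horseshoe contracts (expands) more strongly than every fiber map does anywhere, with the
  rates \<open>s\<close> and \<open>u\<close> of \<^const>\<open>three_legged_horseshoe\<close>.\<close>

definition dominated_rates ::
  "(nat \<Rightarrow> real) \<Rightarrow> (nat \<Rightarrow> real) \<Rightarrow> (nat \<Rightarrow> real \<Rightarrow> real) \<Rightarrow> bool" where
  "dominated_rates s u f \<longleftrightarrow>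
     (\<forall>i\<in>{0, 1, 2}. \<forall>j\<in>{0, 1, 2}. \<forall>x\<in>{0..1}.
        \<bar>s i\<bar> < \<bar>fderiv (f j) x\<bar> \<and> \<bar>fderiv (f j) x\<bar> < \<bar>u i\<bar>)"

definition lam0 :: "(nat \<Rightarrow> real \<Rightarrow> real) \<Rightarrow> real" where
  "lam0 f = fderiv (f 0) 1"

definition beta0 :: "(nat \<Rightarrow> real \<Rightarrow> real) \<Rightarrow> real" where
  "beta0 f = fderiv (f 0) 0"

definition beta2 :: "(nat \<Rightarrow> real \<Rightarrow> real) \<Rightarrow> real" where
  "beta2 f = fderiv (f 2) 0"

definition beta02_minus :: "(nat \<Rightarrow> real \<Rightarrow> real) \<Rightarrow> real" where
  "beta02_minus f = min (beta0 f) (beta2 f)"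

definition beta02_plus :: "(nat \<Rightarrow> real \<Rightarrow> real) \<Rightarrow> real" where
  "beta02_plus f = max (beta0 f) (beta2 f)"

definition F0 :: "(nat \<Rightarrow> real \<Rightarrow> real) \<Rightarrow> bool" where
  "F0 f \<longleftrightarrow>
     strict_mono_on {0..1} (f 0) \<and>
     {x \<in> {0..1}. f 0 x = x} = {0, 1} \<and>
     1 < beta0 f \<and> 0 < lam0 f \<and> lam0 f < 1 \<and>
     (\<forall>x\<in>{0..1}. lam0 f \<le> fderiv (f 0) x)"

definition F1 :: "(nat \<Rightarrow> real \<Rightarrow> real) \<Rightarrow> real \<Rightarrow> bool" where
  "F1 f \<gamma> \<longleftrightarrow> (\<forall>x\<in>{0..1}. f 1 x = \<gamma> * (1 - x)) \<and> lam0 f \<le> \<gamma> \<and> \<gamma> < 1"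

definition F2 :: "(nat \<Rightarrow> real \<Rightarrow> real) \<Rightarrow> bool" where
  "F2 f \<longleftrightarrow>
     strict_mono_on {0..1} (f 2) \<and>
     f 2 0 = 0 \<and> 1 < beta2 f \<and>
     (\<exists>p2. 0 < p2 \<and> p2 < 1 \<and> f 2 p2 = p2 \<and> \<bar>fderiv (f 2) p2\<bar> < 1)"

text \<open>
  \<^const>\<open>F2\<close> does not bound the derivative of \<open>f 2\<close> from below by \<^const>\<open>lam0\<close>.  The lower end point
  of the central spectrum needs such a bound (the fixed point of the skew product over \<open>p2\<close>
  has central exponent \<open>ln (fderiv (f 2) p2)\<close>), so it has to be assumed separately.
\<close>

definition F01 :: "(nat \<Rightarrow> real \<Rightarrow> real) \<Rightarrow> real \<Rightarrow> bool" where
  "F01 f \<gamma> \<longleftrightarrow>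
     antimono_on {0..1} (fderiv (f 0)) \<and>
     \<gamma> * (lam0 f ^ 3 * (1 - lam0 f) / (1 - inverse (beta0 f))) > 1"

text \<open>
  \<open>\<beta>'\<close> is a supremum because the points outside \<open>H\<close> form the half-open interval from \<open>\<delta>\<close> to 1,
  on which the monotone derivative of \<open>f 0\<close> need not attain its maximum.  The number \<open>L\<close> has to
  be quantified existentially: the last inequality fails for all large \<open>L\<close>.
\<close>

definition F012 :: "(nat \<Rightarrow> real \<Rightarrow> real) \<Rightarrow> real \<Rightarrow> bool" where
  "F012 f \<gamma> \<longleftrightarrow>
     (\<forall>x\<in>{0..1}. fderiv (f 0) x \<le> beta02_plus f \<and> fderiv (f 2) x \<le> beta02_plus f) \<and>
     (\<exists>\<delta>. 0 < \<delta> \<and> \<delta> \<le> 1 \<and>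
       (let H = {0..\<delta>};
            H' = {x \<in> {0..1}. f 1 x \<in> H};
            \<beta>' = Sup (fderiv (f 0) ` ({0..1} - H) \<union> fderiv (f 2) ` ({0..1} - H));
            \<beta>H = Inf (fderiv (f 0) ` H \<union> fderiv (f 2) ` H);
            lam' = Sup (fderiv (f 0) ` H')
        in f 1 ` H \<inter> H = {} \<and>
           f 1 ` H' \<inter> H' = {} \<and>
           f 1 ` {0..1} \<inter> H' = {} \<and>
           f 2 ` {0..1} \<inter> H' = {} \<and>
           \<beta>' < beta02_minus f \<and>
           \<beta>H < beta02_minus f \<and>
           lam' < 1 \<and>
           \<bar>ln (lam0 f)\<bar> * (ln (beta02_plus f) / ln \<beta>H) - \<bar>ln lam'\<bar> + 2/3 * ln (beta02_plus f)
             < 3/4 * ln \<beta>' \<and>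
           (\<exists>L::real. 1 \<le> L \<and>
              L > 4 * (\<bar>ln (lam0 f)\<bar> * ln (beta02_plus f) / (ln \<beta>H * ln \<beta>')) \<and>
              ln ((beta02_plus f powr L) * \<gamma>) / (L + 1) < ln \<beta>')))"


section \<open>The skew product\<close>

text \<open>Only the values on \<^term>\<open>(R 0 \<union> R 1 \<union> R 2) \<times> {0..1}\<close> are meaningful.\<close>

definition skew ::
  "(real \<times> real \<Rightarrow> real \<times> real) \<Rightarrow> (nat \<Rightarrow> (real \<times> real) set) \<Rightarrow> (nat \<Rightarrow> real \<Rightarrow> real) \<Rightarrow>
   (real \<times> real) \<times> real \<Rightarrow> (real \<times> real) \<times> real" where
  "skew \<Phi> R f = (\<lambda>(X, x).
     (\<Phi> X, if X \<in> R 0 then f 0 x else if X \<in> R 1 then f 1 x else f 2 x))"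

definition Lambda ::
  "(real \<times> real \<Rightarrow> real \<times> real) \<Rightarrow> (nat \<Rightarrow> (real \<times> real) set) \<Rightarrow> (nat \<Rightarrow> real \<Rightarrow> real) \<Rightarrow>
   ((real \<times> real) \<times> real) set" where
  "Lambda \<Phi> R f =
     max_invariant ((R 0 \<union> R 1 \<union> R 2) \<times> {0..1}) (skew \<Phi> R f) (({0..1} \<times> {0..1}) \<times> {0..1})"

definition ergodic_measures ::
  "('a::topological_space \<Rightarrow> 'a) \<Rightarrow> 'a set \<Rightarrow> 'a measure set" where
  "ergodic_measures F S = {\<mu>.
     prob_space \<mu> \<and> sets \<mu> = sets (restrict_space borel S) \<and>
     F \<in> measurable \<mu> \<mu> \<and> distr \<mu> \<mu> F = \<mu> \<and>
     (\<forall>A\<in>sets \<mu>. F -` A \<inter> space \<mu> = A \<longrightarrow> emeasure \<mu> A = 0 \<or> emeasure \<mu> A = 1)}"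

text \<open>\<open>E\<^sup>c\<close> is the direction of the fiber coordinate, so the derivative of \<open>F\<close> restricted to \<open>E\<^sup>c\<close>
  is the partial derivative of \<open>F\<close> with respect to that coordinate.\<close>

definition central_exponent ::
  "((real \<times> real) \<times> real \<Rightarrow> (real \<times> real) \<times> real) \<Rightarrow> ((real \<times> real) \<times> real) measure \<Rightarrow> real" where
  "central_exponent F \<mu> =
     (\<integral>(X, x). ln (norm (vector_derivative (\<lambda>t. F (X, t)) (at x within {0..1}))) \<partial>\<mu>)"


section \<open>Exponents of the iterated function system\<close>

text \<open>The composition \<open>f_[w]\<close>, which applies the first letter of the word \<open>w\<close> first, is
  \<^term>\<open>fold f w\<close>.\<close>

definition upper_exponent :: "(nat \<Rightarrow> real \<Rightarrow> real) \<Rightarrow> real \<Rightarrow> (int \<Rightarrow> nat) \<Rightarrow> ereal" where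
  "upper_exponent f p \<xi> =
     limsup (\<lambda>n. ereal (1 / real n * ln \<bar>fderiv (fold f (map \<xi> [0..int n - 1])) p\<bar>))"

definition admissible :: "(nat \<Rightarrow> real \<Rightarrow> real) \<Rightarrow> real \<Rightarrow> (int \<Rightarrow> nat) \<Rightarrow> bool" where
  "admissible f x \<xi> \<longleftrightarrow> (\<forall>m\<ge>1. x \<in> fold f (map \<xi> [- int m..-1]) ` {0..1})"

definition exceptional :: "(real \<times> (int \<Rightarrow> nat)) set" where
  "exceptional =
     {(0, \<xi>) | \<xi>. \<forall>j. \<xi> j \<in> {0, 2}} \<union>
     {(1, \<xi>) | \<xi>. \<exists>k::nat. (\<forall>j < int k. \<xi> j = 0) \<and> \<xi> (int k) = 1 \<and>
                        (\<forall>j > int k. \<xi> j \<in> {0, 2})} \<union>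
     {(0, \<xi>) | \<xi>. \<exists>k::nat. (\<forall>j < - int k - 1. \<xi> j = 0) \<and> \<xi> (- int k - 1) = 1 \<and>
                        (\<forall>j \<ge> - int k. \<xi> j \<in> {0, 2})}"

text \<open>
  Pairs are admissible by convention.  Here the convention matters: a pair \<open>(0, \<xi>)\<close> whose forward
  symbols are all 0 or 2, but whose past is not admissible for 0, is not exceptional, and its
  exponent can be as large as the logarithm of \<^const>\<open>beta02_plus\<close>.
\<close>

definition beta_tilde :: "(nat \<Rightarrow> real \<Rightarrow> real) \<Rightarrow> real" where
  "beta_tilde f = exp (real_of_ereal (Sup {upper_exponent f p \<xi> | p \<xi>.
     p \<in> {0..1} \<and> \<xi> \<in> Sigma3 \<and> admissible f p \<xi> \<and> (p, \<xi>) \<notin> exceptional}))"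

end

theory Submission
  imports Defs
begin

text \<open>
  The sets of points of \<open>\<Lambda>\<close> whose symbol sequence contains the symbol 1 exactly once, at a given
  position, are disjoint and permuted by \<open>F\<close>, hence null for every invariant probability measure.
  So up to a null set the exceptional pairs are those over the invariant set \<open>E\<close> given by
  \<open>x = 0\<close> and \<open>\<xi> \<in> {0, 2}\<^sup>\<int>\<close>. If \<open>E\<close> has full measure, then the central exponent averages \<open>ln (beta0 f)\<close>
  and \<open>ln (beta2 f)\<close>. Otherwise \<open>E\<close> is null by ergodicity, almost every point is non-exceptional,
  and the limsup of the Birkhoff averages of the bounded function \<open>ln \<bar>f'\<bar>\<close> is almost everywhere at
  most \<open>ln (beta_tilde f)\<close>. All these averages have the same integral, so dominated
  convergence bounds the central exponent, and Birkhoff's theorem is not required.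
\<close>

section \<open>Maximal invariant sets\<close>

text \<open>Iterated images under a partial map become orbits of the total map \<open>F\<close> that
  stay in \<open>D\<close> before their last step; later arguments only handle such orbits.\<close>

lemma funpow_image_iff:
  "p \<in> ((\<lambda>A. F ` (A \<inter> D)) ^^ n) C \<longleftrightarrow> (\<exists>q\<in>C. (F ^^ n) q = p \<and> (\<forall>k<n. (F ^^ k) q \<in> D))"
  by (induction n arbitrary: p) (auto simp: less_Suc_eq image_iff, metis)

lemma funpow_preimage_iff:
  "p \<in> ((\<lambda>A. {X \<in> D. F X \<in> A}) ^^ n) C \<longleftrightarrow> (F ^^ n) p \<in> C \<and> (\<forall>k<n. (F ^^ k) p \<in> D)"
  by (induction n arbitrary: p) (auto simp: less_Suc_eq_0_disj funpow_swap1)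

lemma max_invariant_iff:
  "p \<in> max_invariant D F C \<longleftrightarrow>
     (\<forall>n. \<exists>q\<in>C. (F ^^ n) q = p \<and> (\<forall>k<n. (F ^^ k) q \<in> D)) \<and>
     (\<forall>n. (F ^^ n) p \<in> C \<and> (\<forall>k<n. (F ^^ k) p \<in> D))"
  by (simp add: max_invariant_def funpow_image_iff funpow_preimage_iff)

lemma max_invariant_forward:
  assumes "p \<in> max_invariant D F C"
  shows "(F ^^ n) p \<in> C"
  using assms by (simp add: max_invariant_iff)

lemma max_invariant_backward:
  assumes "p \<in> max_invariant D F C"
  obtains q where "q \<in> C" "(F ^^ n) q = p"
  using assms unfolding max_invariant_iff by blast

text \<open>Injectivity cancels the last step of a backward orbit ending in \<open>F p\<close>,
  which leaves one ending in \<open>p\<close>. Conversely, appending a step to a backward orbit of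
  \<open>p\<close> gives one of \<open>F p\<close>.\<close>

lemma max_invariant_UNIV_iff:
  assumes "inj F"
  shows "F p \<in> max_invariant UNIV F C \<longleftrightarrow> p \<in> max_invariant UNIV F C"
proof
  assume a: "F p \<in> max_invariant UNIV F C"
  have q: "\<exists>q\<in>C. (F ^^ n) q = p" for n
  proof -
    obtain q where "q \<in> C" "(F ^^ Suc n) q = F p"
      using max_invariant_backward[OF a] .
    then show ?thesis using injD[OF assms] by auto
  qed
  have "(F ^^ n) p \<in> C" for n
  proof (cases n)
    case 0
    \<comment> \<open>The forward orbit of \<open>F p\<close> says nothing about \<open>p\<close>
      itself; that \<open>p\<close> lies in \<open>C\<close> comes from the case of length 0 of
      \<open>q\<close>.\<close>
    then show ?thesis using q[of 0] by auto
  next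
    case (Suc m)
    then show ?thesis using a by (auto simp: max_invariant_iff funpow_swap1)
  qed
  then show "p \<in> max_invariant UNIV F C" using q by (simp add: max_invariant_iff)
next
  assume a: "p \<in> max_invariant UNIV F C"
  have fw: "(F ^^ n) (F p) \<in> C" for n
    using a unfolding max_invariant_iff by (metis funpow_Suc_right comp_apply)
  have "\<exists>q\<in>C. (F ^^ n) q = F p" for n
  proof (cases n)
    case 0
    then show ?thesis using fw[of 0] by auto
  next
    case (Suc m)
    then show ?thesis using a by (auto simp: max_invariant_iff)
  qed
  then show "F p \<in> max_invariant UNIV F C" using fw by (simp add: max_invariant_iff)
qed

lemma fst_skew_funpow: "fst ((skew \<Phi> R f ^^ n) p) = (\<Phi> ^^ n) (fst p)"
  by (induction n) (auto simp: skew_def split: prod.splits)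


section \<open>Derivatives along words\<close>

lemma all_int_shift: "(\<forall>j::int. P (j + 1)) \<longleftrightarrow> (\<forall>j. P j)"
  by (metis diff_add_cancel)

lemma upto_int_Suc: "[0..int (Suc n) - 1] = [0..int n - 1] @ [int n]"
  using upto_rec2[of 0 "int n"] by simp

lemma set_map_subset: "range g \<subseteq> A \<Longrightarrow> set (map g xs) \<subseteq> A"
  by auto

lemma fderiv_eqI:
  assumes "(g has_real_derivative d) (at x within {0..1})" "x \<in> {0..1}"
  shows "fderiv g x = d"
  using vector_derivative_within_cbox[of 0 1 x g d] assms
  by (simp add: fderiv_def has_real_derivative_iff_has_vector_derivative)

lemma fiber_has_derivative:
  assumes "fiber_maps f" "i \<in> {0, 1, 2}" "x \<in> {0..1}"
  shows "(f i has_real_derivative fderiv (f i) x) (at x within {0..1})"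
proof -
  obtain g' where "(f i has_real_derivative g' x) (at x within {0..1})"
    using assms unfolding fiber_maps_def C1_unit_interval_def by blast
  then show ?thesis using fderiv_eqI assms(3) by metis
qed

lemma continuous_on_fderiv:
  assumes "fiber_maps f" "i \<in> {0, 1, 2}"
  shows "continuous_on {0..1} (fderiv (f i))"
proof -
  obtain g' where "continuous_on {0..1} g'"
    and "\<forall>x\<in>{0..1}. (f i has_real_derivative g' x) (at x within {0..1})"
    using assms unfolding fiber_maps_def C1_unit_interval_def by blast
  then show ?thesis using fderiv_eqI by (metis (no_types, lifting) continuous_on_cong)
qed

lemma fold_fiber_maps_in:
  assumes "fiber_maps f" "set w \<subseteq> {0, 1, 2}" "x \<in> {0..1}"
  shows "fold f w x \<in> {0..1}"
  using assms(2,3)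
proof (induction w arbitrary: x)
  case (Cons i w)
  have "i \<in> {0, 1, 2}" using Cons.prems(1) by simp
  then have "f i ` {0..1} \<subseteq> {0..1}" using assms(1) unfolding fiber_maps_def by blast
  then have "f i x \<in> {0..1}" using Cons.prems(2) by (rule subsetD[OF _ imageI])
  then show ?case using Cons.IH Cons.prems(1) by simp
qed simp

text \<open>The last letter of a word is the outermost map of the composition, so induction from the
  right needs one chain rule per letter.\<close>

lemma fold_fiber_maps_derivative:
  assumes "fiber_maps f" "set w \<subseteq> {0, 1, 2}" "x \<in> {0..1}"
  shows "(fold f w has_real_derivative fderiv (fold f w) x) (at x within {0..1})"
  using assms(2)
proof (induction w rule: rev_induct)
  case Nil
  have "(fold f [] has_real_derivative 1) (at x within {0..1})"
    by (simp add: id_def)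
  then show ?case using fderiv_eqI assms(3) by metis
next
  case (snoc i w)
  \<comment> \<open>The chain rule within a set asks for the outer derivative within the image of
    the inner map, and that image lies in the unit interval.\<close>
  have "(f i has_real_derivative fderiv (f i) (fold f w x)) (at (fold f w x) within fold f w ` {0..1})"
  proof (rule DERIV_subset)
    show "(f i has_real_derivative fderiv (f i) (fold f w x)) (at (fold f w x) within {0..1})"
      using fiber_has_derivative[OF assms(1) _ fold_fiber_maps_in[OF assms(1) _ assms(3)]] snoc.prems
      by simp
    show "fold f w ` {0..1} \<subseteq> {0..1}"
      using fold_fiber_maps_in[OF assms(1), of w] snoc.prems by (intro image_subsetI) simp
  qed
  from DERIV_image_chain[OF this snoc.IH] snoc.prems
  have "(fold f (w @ [i]) has_real_derivative fderiv (f i) (fold f w x) * fderiv (fold f w) x)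
          (at x within {0..1})"
    by (simp add: comp_def)
  then show ?case using fderiv_eqI assms(3) by metis
qed

lemma fderiv_fold_snoc:
  assumes "fiber_maps f" "set w \<subseteq> {0, 1, 2}" "i \<in> {0, 1, 2}" "x \<in> {0..1}"
  shows "fderiv (fold f (w @ [i])) x = fderiv (f i) (fold f w x) * fderiv (fold f w) x"
proof (rule fderiv_eqI)
  have "(f i has_real_derivative fderiv (f i) (fold f w x)) (at (fold f w x) within fold f w ` {0..1})"
  proof (rule DERIV_subset)
    show "(f i has_real_derivative fderiv (f i) (fold f w x)) (at (fold f w x) within {0..1})"
      using fiber_has_derivative[OF assms(1,3) fold_fiber_maps_in[OF assms(1,2,4)]] .
    show "fold f w ` {0..1} \<subseteq> {0..1}"
      using fold_fiber_maps_in[OF assms(1,2)] by (rule image_subsetI)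
  qed
  from DERIV_image_chain[OF this fold_fiber_maps_derivative[OF assms(1,2,4)]]
  show "(fold f (w @ [i]) has_real_derivative fderiv (f i) (fold f w x) * fderiv (fold f w) x)
          (at x within {0..1})"
    by (simp add: comp_def)
qed fact

text \<open>The chain rule makes the derivative along a word a product, and the logarithm turns it
  into a sum along the orbit. Nonvanishing is carried through the induction so that the logarithm of
  each new product can be split.\<close>

lemma ln_fderiv_fold:
  assumes "fiber_maps f" "range \<xi> \<subseteq> {0, 1, 2}" "x \<in> {0..1}"
    and "\<And>i y. i \<in> {0, 1, 2} \<Longrightarrow> y \<in> {0..1} \<Longrightarrow> fderiv (f i) y \<noteq> 0"
  shows "fderiv (fold f (map \<xi> [0..int n - 1])) x \<noteq> 0 \<and>
    ln \<bar>fderiv (fold f (map \<xi> [0..int n - 1])) x\<bar> =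
      (\<Sum>k<n. ln \<bar>fderiv (f (\<xi> (int k))) (fold f (map \<xi> [0..int k - 1]) x)\<bar>)"
proof (induction n)
  case 0
  have "fderiv (\<lambda>a. a) x = 1" by (rule fderiv_eqI) (use assms in auto)
  then show ?case by (simp add: id_def)
next
  case (Suc n)
  note w = set_map_subset[OF assms(2), of "[0..int n - 1]"]
    and i = range_subsetD[OF assms(2), of "int n"]
  have "fderiv (f (\<xi> (int n))) (fold f (map \<xi> [0..int n - 1]) x) \<noteq> 0"
    using assms(4)[OF i fold_fiber_maps_in[OF assms(1) w assms(3)]] .
  then show ?case
    using Suc fderiv_fold_snoc[OF assms(1) w i assms(3)]
    unfolding upto_int_Suc by (simp add: abs_mult ln_mult comp_def)
qed


section \<open>Ergodic measures of the skew product\<close>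

text \<open>If the limsup of the Birkhoff averages is at most \<open>L\<close>, then their maximum with \<open>L\<close>
  converges to \<open>L\<close>, and dominated convergence applies.\<close>

lemma (in prob_space) integral_le_limsup_averages:
  fixes g :: "'a \<Rightarrow> real"
  assumes T: "T \<in> measurable M M" "distr M M T = M"
    and g: "g \<in> borel_measurable M" "\<And>p. p \<in> space M \<Longrightarrow> \<bar>g p\<bar> \<le> B"
    and L: "AE p in M. limsup (\<lambda>n. ereal (1 / real n * (\<Sum>k<n. g ((T ^^ k) p)))) \<le> ereal L"
  shows "integral\<^sup>L M g \<le> L"
proof -
  define a where "a n p = 1 / real n * (\<Sum>k<n. g ((T ^^ k) p))" for n p
  have Tk: "T ^^ k \<in> measurable M M" for k
    by (induction k) (simp_all add: id_def measurable_compose[OF _ T(1)])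
  have gk: "(\<lambda>p. g ((T ^^ k) p)) \<in> borel_measurable M" for k
    using measurable_compose[OF Tk g(1)] .
  have am: "a n \<in> borel_measurable M" for n
    unfolding a_def using gk by measurable
  have bk: "\<bar>g ((T ^^ k) p)\<bar> \<le> B" if "p \<in> space M" for k p
    using g(2) measurable_space[OF Tk that] .
  \<comment> \<open>A probability space has a point, and there \<open>B\<close> bounds an absolute
    value. This settles the average of index 0, which is 0.\<close>
  have B0: "0 \<le> B" using not_empty g(2) by force
  have ab: "\<bar>a n p\<bar> \<le> B" if "p \<in> space M" for n p
  proof -
    have "\<bar>\<Sum>k<n. g ((T ^^ k) p)\<bar> \<le> (\<Sum>k<n. B)"
      using bk[OF that] by (intro order.trans[OF sum_abs] sum_mono)
    then have S: "\<bar>\<Sum>k<n. g ((T ^^ k) p)\<bar> \<le> B * real n" by (simp add: mult.commute)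
    show ?thesis
    proof (cases "n = 0")
      case True
      then show ?thesis using B0 by (simp add: a_def)
    next
      case False
      then have "\<bar>a n p\<bar> = \<bar>\<Sum>k<n. g ((T ^^ k) p)\<bar> / real n" by (simp add: a_def)
      also have "\<dots> \<le> B" using S False by (simp add: pos_divide_le_eq)
      finally show ?thesis .
    qed
  qed
  have int_gk: "integrable M (\<lambda>p. g ((T ^^ k) p))" for k
    by (rule integrable_const_bound[where B = B]) (use bk gk in auto)
  have inv: "(\<integral>p. g ((T ^^ k) p) \<partial>M) = integral\<^sup>L M g" for k
  proof (induction k)
    case (Suc k)
    have "(\<integral>p. g ((T ^^ k) p) \<partial>distr M M T) = (\<integral>p. g ((T ^^ k) (T p)) \<partial>M)"
      by (rule integral_distr[OF T(1) gk])
    then show ?case using Suc T(2) by (simp add: funpow_swap1)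
  qed simp
  have ia: "integral\<^sup>L M (a n) = integral\<^sup>L M g" if "n > 0" for n
    using that int_gk inv unfolding a_def by (simp add: Bochner_Integration.integral_sum)
  have lim: "(\<lambda>n. \<integral>p. max (a n p) L \<partial>M) \<longlonglongrightarrow> (\<integral>p. L \<partial>M)"
  proof (rule integral_dominated_convergence[where w = "\<lambda>_. B + \<bar>L\<bar>"])
    show "AE p in M. (\<lambda>n. max (a n p) L) \<longlonglongrightarrow> L"
      using L unfolding a_def[symmetric]
    proof eventually_elim
      case (elim p)
      show ?case
      \<comment> \<open>Only the upper side uses the bound on the limsup; the lower side holds
        because of the maximum with \<open>L\<close>.\<close>
      proof (rule order_tendstoI)
        fix c assume "L < c"
        then have "limsup (\<lambda>n. ereal (a n p)) < ereal c"
          using elim by (auto intro: le_less_trans[where y = "ereal L"])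
        from Limsup_lessD[OF this] show "\<forall>\<^sub>F n in sequentially. max (a n p) L < c"
          by (rule eventually_mono) (use \<open>L < c\<close> in simp)
      next
        fix c assume "c < L"
        then show "\<forall>\<^sub>F n in sequentially. c < max (a n p) L"
          by (simp add: less_max_iff_disj)
      qed
    qed
    show "AE p in M. norm (max (a n p) L) \<le> B + \<bar>L\<bar>" for n
    proof (rule AE_I2)
      fix p assume "p \<in> space M"
      from ab[OF this, of n] show "norm (max (a n p) L) \<le> B + \<bar>L\<bar>"
        unfolding real_norm_def by linarith
    qed
  qed (use am in auto)
  have "integral\<^sup>L M g \<le> (\<integral>p. max (a n p) L \<partial>M)" if "n > 0" for n
    unfolding ia[OF that, symmetric]
  proof (rule integral_mono)
    show "integrable M (a n)"
      by (rule integrable_const_bound[where B = B]) (use ab am in auto)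
    then show "integrable M (\<lambda>p. max (a n p) L)" by simp
  qed simp
  then have "integral\<^sup>L M g \<le> (\<integral>p. L \<partial>M)"
    by (intro tendsto_lowerbound[OF lim]) (auto intro: eventually_mono[OF eventually_gt_at_top[of 0]])
  then show ?thesis by (simp add: prob_space)
qed

text \<open>Invariance of the measure gives all \<open>W k\<close> the same probability, and
  infinitely many disjoint sets of equal positive probability do not fit into a probability
  space.\<close>

lemma (in prob_space) wandering_null:
  fixes W :: "int \<Rightarrow> 'a set"
  assumes T: "T \<in> measurable M M" "distr M M T = M"
    and W: "\<And>k. W k \<in> sets M" "disjoint_family W"
    and step: "\<And>k. T -` W k \<inter> space M = W (k + 1)"
  shows "emeasure M (W k) = 0"
proof -
  have eq: "prob (W (k + 1)) = prob (W k)" for k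
    using measure_distr[OF T(1) W(1)[of k]] T(2) step by simp
  have const: "prob (W k) = prob (W 0)" for k
  proof (induction k rule: int_induct[where k = 0])
    case (step2 i)
    then show ?case using eq[of "i - 1"] by simp
  qed (simp_all add: eq)
  \<comment> \<open>The sets with nonnegative index already suffice: their probabilities form a
    convergent series with constant terms.\<close>
  have "(\<lambda>n. prob (W (int n))) sums prob (\<Union>n. W (int n))"
    using W by (intro finite_measure_UNION) (auto simp: disjoint_family_on_def)
  then have "summable (\<lambda>n. prob (W (int n)))" by (rule sums_summable)
  then have "prob (W 0) = 0" unfolding const[of "int _"] by (simp add: summable_const_iff)
  then show ?thesis using const[of k] by (simp add: emeasure_eq_measure)
qed

section \<open>Orbits of the skew product, read through their symbol sequences\<close>

text \<open>The bounds \<open>a\<close> and \<open>b\<close> on the absolute derivatives keep their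
  logarithms bounded; \<open>ln a\<close> becomes the lower bound for all central exponents.\<close>

locale horseshoe_skew_product =
  fixes \<Phi> :: "real \<times> real \<Rightarrow> real \<times> real"
    and \<Gamma> :: "(real \<times> real) set"
    and \<omega> :: "real \<times> real \<Rightarrow> int \<Rightarrow> nat"
    and R :: "nat \<Rightarrow> (real \<times> real) set"
    and s u :: "nat \<Rightarrow> real"
    and f :: "nat \<Rightarrow> real \<Rightarrow> real"
    and a b :: real
  assumes base: "three_legged_horseshoe \<Phi> \<Gamma> \<omega> R s u"
    and fibers: "fiber_maps f"
    and a_pos: "0 < a"
    and bounds: "\<And>i x. i \<in> {0, 1, 2} \<Longrightarrow> x \<in> {0..1} \<Longrightarrow> a \<le> \<bar>fderiv (f i) x\<bar> \<and> \<bar>fderiv (f i) x\<bar> \<le> b"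
begin

text \<open>The potential of the problem: its integral is the central exponent, and its Birkhoff
  sums are the logarithms of derivatives along words.\<close>

definition \<phi> :: "(real \<times> real) \<times> real \<Rightarrow> real" where
  "\<phi> p = ln \<bar>fderiv (f (\<omega> (fst p) 0)) (snd p)\<bar>"

lemma fderiv_nonzero: "i \<in> {0, 1, 2} \<Longrightarrow> x \<in> {0..1} \<Longrightarrow> fderiv (f i) x \<noteq> 0"
  using bounds a_pos by force

lemma ln_bounds:
  assumes "i \<in> {0, 1, 2}" "x \<in> {0..1}"
  shows "ln a \<le> ln \<bar>fderiv (f i) x\<bar>" "ln \<bar>fderiv (f i) x\<bar> \<le> ln b"
  using bounds[OF assms] a_pos by auto

lemma horseshoe_diffeomorphism: "C1_diffeomorphism \<Phi>"
  and Gamma_eq: "\<Gamma> = max_invariant UNIV \<Phi> ({0..1} \<times> {0..1})"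
  and horseshoe_conjugation: "\<exists>\<omega>'. homeomorphism \<Gamma> Sigma3 \<omega> \<omega>'"
  and symbol_step: "\<forall>X\<in>\<Gamma>. \<omega> (\<Phi> X) = shift (\<omega> X)"
  and symbol_rectangle: "\<forall>i\<in>{0, 1, 2}. \<forall>X\<in>\<Gamma>. X \<in> R i \<longleftrightarrow> \<omega> X 0 = i"
proof -
  note facts = base[unfolded three_legged_horseshoe_def]
  show "C1_diffeomorphism \<Phi>" using facts by (elim conjE)
  show "\<Gamma> = max_invariant UNIV \<Phi> ({0..1} \<times> {0..1})" using facts by (elim conjE)
  show "\<exists>\<omega>'. homeomorphism \<Gamma> Sigma3 \<omega> \<omega>'" using facts by (elim conjE)
  show "\<forall>X\<in>\<Gamma>. \<omega> (\<Phi> X) = shift (\<omega> X)" using facts by (elim conjE)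
  show "\<forall>i\<in>{0, 1, 2}. \<forall>X\<in>\<Gamma>. X \<in> R i \<longleftrightarrow> \<omega> X 0 = i" using facts by (elim conjE)
qed

lemma Gamma_step: "\<Phi> X \<in> \<Gamma> \<longleftrightarrow> X \<in> \<Gamma>"
  using horseshoe_diffeomorphism unfolding Gamma_eq C1_diffeomorphism_def
  by (intro max_invariant_UNIV_iff) (simp add: bij_is_inj)

lemma Gamma_funpow: "(\<Phi> ^^ n) X \<in> \<Gamma> \<longleftrightarrow> X \<in> \<Gamma>"
  by (induction n) (simp_all add: Gamma_step)

lemma symbol_funpow: "X \<in> \<Gamma> \<Longrightarrow> \<omega> ((\<Phi> ^^ n) X) j = \<omega> X (j + int n)"
proof (induction n arbitrary: j)
  case (Suc n)
  have "\<omega> (\<Phi> ((\<Phi> ^^ n) X)) = shift (\<omega> ((\<Phi> ^^ n) X))"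
    using symbol_step Suc.prems Gamma_funpow[of n X] by blast
  then show ?case using Suc by (simp add: shift_def algebra_simps)
qed simp

lemma symbols: "X \<in> \<Gamma> \<Longrightarrow> \<omega> X \<in> Sigma3"
  using horseshoe_conjugation unfolding homeomorphism_def by blast

lemma symbol_in: "X \<in> \<Gamma> \<Longrightarrow> \<omega> X j \<in> {0, 1, 2}"
  using symbols unfolding Sigma3_def by blast

text \<open>On the horseshoe the symbol at position 0 decides which rectangle contains the point, so
  the last branch of \<open>skew\<close> is reached only with symbol 2.\<close>

lemma skew_on_Gamma:
  assumes "X \<in> \<Gamma>"
  shows "skew \<Phi> R f (X, x) = (\<Phi> X, f (\<omega> X 0) x)"
proof -
  have "X \<in> R i \<longleftrightarrow> \<omega> X 0 = i" if "i \<in> {0, 1, 2}" for i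
    using symbol_rectangle[THEN bspec, OF that, THEN bspec, OF assms] .
  from this[of 0] this[of 1] this[of 2] show ?thesis
    using symbol_in[OF assms, of 0] by (auto simp: skew_def)
qed

lemma snd_skew_funpow:
  assumes "fst q \<in> \<Gamma>"
  shows "snd ((skew \<Phi> R f ^^ n) q) = fold f (map (\<omega> (fst q)) [0..int n - 1]) (snd q)"
proof (induction n)
  case (Suc n)
  let ?r = "(skew \<Phi> R f ^^ n) q"
  have "fst ?r \<in> \<Gamma>" using assms by (simp add: fst_skew_funpow Gamma_funpow)
  from skew_on_Gamma[OF this, of "snd ?r"]
  have "snd (skew \<Phi> R f ?r) = f (\<omega> (fst ?r) 0) (snd ?r)" by (simp only: prod.collapse snd_conv)
  then show ?case
    using Suc symbol_funpow[OF assms, of n 0] unfolding upto_int_Suc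
    by (simp add: fst_skew_funpow)
qed simp

text \<open>The first component of an iterate of the skew product is an iterate of
  \<open>\<Phi>\<close>. Forward and backward orbits in the cube therefore project to orbits in the
  square, which characterize the horseshoe.\<close>

lemma Lambda_in:
  assumes "p \<in> Lambda \<Phi> R f"
  shows "fst p \<in> \<Gamma>" "snd p \<in> {0..1}"
proof -
  have fw: "(skew \<Phi> R f ^^ n) p \<in> ({0..1} \<times> {0..1}) \<times> {0..1}" for n
    using max_invariant_forward[OF assms[unfolded Lambda_def]] .
  show "snd p \<in> {0..1}" using fw[of 0] by auto
  have "(\<Phi> ^^ n) (fst p) \<in> {0..1} \<times> {0..1}" for n
    using fw[of n] by (simp only: mem_Times_iff fst_skew_funpow)
  moreover have "\<exists>X\<in>{0..1} \<times> {0..1}. (\<Phi> ^^ n) X = fst p" for n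
  proof -
    obtain q where "q \<in> ({0..1} \<times> {0..1}) \<times> {0..1}" "(skew \<Phi> R f ^^ n) q = p"
      using max_invariant_backward[OF assms[unfolded Lambda_def]] .
    then show ?thesis using fst_skew_funpow[of n \<Phi> R f q]
      by (intro bexI[of _ "fst q"]) (simp_all only: mem_Times_iff)
  qed
  ultimately have "fst p \<in> max_invariant UNIV \<Phi> ({0..1} \<times> {0..1})"
    by (simp add: max_invariant_iff)
  then show "fst p \<in> \<Gamma>" unfolding Gamma_eq .
qed

text \<open>A backward orbit of length \<open>m\<close> in the cube starts at a fiber coordinate
  that is carried to \<open>snd p\<close> by the letters at positions \<open>-m\<close> to
  \<open>-1\<close> of the symbol sequence of \<open>p\<close>.\<close>

lemma Lambda_admissible:
  assumes p: "p \<in> Lambda \<Phi> R f"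
  shows "admissible f (snd p) (\<omega> (fst p))"
  unfolding admissible_def
proof (intro allI impI)
  fix m :: nat assume "m \<ge> 1"
  obtain q where q: "q \<in> ({0..1} \<times> {0..1}) \<times> {0..1}" "(skew \<Phi> R f ^^ m) q = p"
    using max_invariant_backward[OF p[unfolded Lambda_def]] .
  have X: "(\<Phi> ^^ m) (fst q) = fst p" using q(2) fst_skew_funpow[of m \<Phi> R f q] by simp
  then have G: "fst q \<in> \<Gamma>" using Lambda_in(1)[OF p] Gamma_funpow[of m "fst q"] by simp
  \<comment> \<open>The conjugation shifts by one place per step, so positions \<open>-m\<close> to
    \<open>-1\<close> of \<open>p\<close> are positions \<open>0\<close> to \<open>m - 1\<close> of
    \<open>q\<close>.\<close>
  have "[- int m..-1] = map (\<lambda>k. k - int m) [0..int m - 1]"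
    by (rule nth_equalityI) auto
  moreover have "\<omega> (fst p) (k - int m) = \<omega> (fst q) k" for k
    using symbol_funpow[OF G, of m "k - int m"] X by simp
  ultimately have "map (\<omega> (fst p)) [- int m..-1] = map (\<omega> (fst q)) [0..int m - 1]"
    by (simp add: comp_def)
  then have "snd p = fold f (map (\<omega> (fst p)) [- int m..-1]) (snd q)"
    using snd_skew_funpow[OF G, of m] q(2) by simp
  then show "snd p \<in> fold f (map (\<omega> (fst p)) [- int m..-1]) ` {0..1}"
    using q(1) by auto
qed

section \<open>Birkhoff sums of the central derivative and upper exponents\<close>

text \<open>Moving only the fiber coordinate leaves the base component of the image constant, so the
  derivative vector is \<open>(0, f')\<close> and its norm is the absolute value of
  \<open>f'\<close>.\<close>

lemma central_derivative:
  assumes p: "p \<in> Lambda \<Phi> R f"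
  shows "(case p of (X, x) \<Rightarrow>
    ln (norm (vector_derivative (\<lambda>t. skew \<Phi> R f (X, t)) (at x within {0..1})))) = \<phi> p"
proof -
  obtain X x where [simp]: "p = (X, x)" by fastforce
  have X: "X \<in> \<Gamma>" and x: "x \<in> {0..1}" using Lambda_in[OF p] by auto
  let ?g = "f (\<omega> X 0)"
  have "(?g has_vector_derivative fderiv ?g x) (at x within {0..1})"
    using fiber_has_derivative[OF fibers symbol_in[OF X] x]
    by (simp add: has_real_derivative_iff_has_vector_derivative)
  then have "((\<lambda>t. (\<Phi> X, ?g t)) has_vector_derivative (0, fderiv ?g x)) (at x within {0..1})"
    by (intro has_vector_derivative_Pair) auto
  then have "vector_derivative (\<lambda>t. (\<Phi> X, ?g t)) (at x within {0..1}) = (0, fderiv ?g x)"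
    using vector_derivative_within_cbox[of 0 1 x] x by simp
  then show ?thesis by (simp add: skew_on_Gamma[OF X] \<phi>_def norm_Pair)
qed

lemma log_derivative_averages:
  assumes p: "p \<in> Lambda \<Phi> R f"
  shows "ln \<bar>fderiv (fold f (map (\<omega> (fst p)) [0..int n - 1])) (snd p)\<bar> =
    (\<Sum>k<n. \<phi> ((skew \<Phi> R f ^^ k) p))"
proof -
  have G: "fst p \<in> \<Gamma>" and x: "snd p \<in> {0..1}" using Lambda_in[OF p] by auto
  have "\<phi> ((skew \<Phi> R f ^^ k) p) =
    ln \<bar>fderiv (f (\<omega> (fst p) (int k))) (fold f (map (\<omega> (fst p)) [0..int k - 1]) (snd p))\<bar>" for k
    using symbol_funpow[OF G, of k 0] by (simp add: \<phi>_def fst_skew_funpow snd_skew_funpow[OF G])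
  moreover have "range (\<omega> (fst p)) \<subseteq> {0, 1, 2}" using symbol_in[OF G] by (rule image_subsetI)
  ultimately show ?thesis
    using ln_fderiv_fold[OF fibers _ x fderiv_nonzero, of "\<omega> (fst p)" n] by simp
qed

text \<open>Each factor of the chain rule has its logarithm between \<open>ln a\<close> and
  \<open>ln b\<close>, and averages inherit this. The purpose is finiteness of the supremum behind
  \<open>beta_tilde\<close>.\<close>

lemma upper_exponent_bounds:
  assumes "\<xi> \<in> Sigma3" "x \<in> {0..1}"
  shows "ereal (ln a) \<le> upper_exponent f x \<xi>" "upper_exponent f x \<xi> \<le> ereal (ln b)"
proof -
  have r: "range \<xi> \<subseteq> {0, 1, 2}" using assms(1) unfolding Sigma3_def by (intro image_subsetI) simp
  define t where "t n = ln \<bar>fderiv (fold f (map \<xi> [0..int n - 1])) x\<bar>" for n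
  have log_step: "ln a \<le> ln \<bar>fderiv (f (\<xi> (int k))) (fold f (map \<xi> [0..int k - 1]) x)\<bar>"
    "ln \<bar>fderiv (f (\<xi> (int k))) (fold f (map \<xi> [0..int k - 1]) x)\<bar> \<le> ln b" for k
  proof -
    from ln_bounds[OF range_subsetD[OF r] fold_fiber_maps_in[OF fibers set_map_subset[OF r] assms(2)]]
    show "ln a \<le> ln \<bar>fderiv (f (\<xi> (int k))) (fold f (map \<xi> [0..int k - 1]) x)\<bar>"
      "ln \<bar>fderiv (f (\<xi> (int k))) (fold f (map \<xi> [0..int k - 1]) x)\<bar> \<le> ln b" .
  qed
  have t: "t n = (\<Sum>k<n. ln \<bar>fderiv (f (\<xi> (int k))) (fold f (map \<xi> [0..int k - 1]) x)\<bar>)" for n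
    using ln_fderiv_fold[OF fibers r assms(2) fderiv_nonzero, of n] by (simp add: t_def)
  have "real n * ln a \<le> t n" "t n \<le> real n * ln b" for n
    unfolding t
    using sum_mono[of "{..<n}" "\<lambda>_. ln a", OF log_step(1)] sum_mono[of "{..<n}" _ "\<lambda>_. ln b", OF log_step(2)]
    by auto
  then have "ln a \<le> 1 / real n * t n" "1 / real n * t n \<le> ln b" if "n > 0" for n
    using that by (simp_all add: field_simps)
  then have ev: "\<forall>\<^sub>F n in sequentially. ereal (ln a) \<le> ereal (1 / real n * t n)"
    "\<forall>\<^sub>F n in sequentially. ereal (1 / real n * t n) \<le> ereal (ln b)"
    by (auto intro: eventually_mono[OF eventually_gt_at_top[of 0]])
  show "upper_exponent f x \<xi> \<le> ereal (ln b)"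
    using Limsup_bounded[OF ev(2)] by (simp add: upper_exponent_def t_def)
  have "ereal (ln a) \<le> liminf (\<lambda>n. ereal (1 / real n * t n))"
    by (rule Liminf_bounded[OF ev(1)])
  also have "\<dots> \<le> limsup (\<lambda>n. ereal (1 / real n * t n))"
    by (rule Liminf_le_Limsup) simp
  finally show "ereal (ln a) \<le> upper_exponent f x \<xi>" by (simp add: upper_exponent_def t_def)
qed

lemma upper_exponent_le_beta_tilde:
  assumes p: "p \<in> Lambda \<Phi> R f" and ne: "(snd p, \<omega> (fst p)) \<notin> exceptional"
  shows "upper_exponent f (snd p) (\<omega> (fst p)) \<le> ereal (ln (beta_tilde f))"
proof -
  define S where "S = Sup {upper_exponent f p \<xi> | p \<xi>.
     p \<in> {0..1} \<and> \<xi> \<in> Sigma3 \<and> admissible f p \<xi> \<and> (p, \<xi>) \<notin> exceptional}"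
  have s: "\<omega> (fst p) \<in> Sigma3" "snd p \<in> {0..1}" using Lambda_in[OF p] symbols by auto
  have le: "upper_exponent f (snd p) (\<omega> (fst p)) \<le> S"
    unfolding S_def using s Lambda_admissible[OF p] ne by (intro Sup_upper) blast
  \<comment> \<open>Infinite values must be excluded, since \<open>real_of_ereal\<close> sends them
    to 0. The exponent at hand shows that the supremum is not taken over the empty set.\<close>
  then have "ereal (ln a) \<le> S" using upper_exponent_bounds(1)[OF s] by (rule order.trans[rotated])
  moreover have "S \<le> ereal (ln b)"
    unfolding S_def using upper_exponent_bounds(2) by (intro Sup_least) blast
  ultimately have "ereal (real_of_ereal S) = S"
    by (cases S) auto
  then show ?thesis using le by (simp add: beta_tilde_def S_def)
qed

lemma symbol_skew:
  assumes "p \<in> Lambda \<Phi> R f"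
  shows "\<omega> (fst (skew \<Phi> R f p)) j = \<omega> (fst p) (j + 1)"
  using symbol_funpow[OF Lambda_in(1)[OF assms], of 1 j] fst_skew_funpow[of 1 \<Phi> R f p] by simp

section \<open>An ergodic measure: measurability and the integral form of its exponent\<close>

context
  fixes \<mu>
  assumes \<mu>: "\<mu> \<in> ergodic_measures (skew \<Phi> R f) (Lambda \<Phi> R f)"
begin

lemma ergodic_prob: "prob_space \<mu>"
  and ergodic_sets: "sets \<mu> = sets (restrict_space borel (Lambda \<Phi> R f))"
  and ergodic_measurable: "skew \<Phi> R f \<in> measurable \<mu> \<mu>"
  and ergodic_distr: "distr \<mu> \<mu> (skew \<Phi> R f) = \<mu>"
  and ergodic_01: "A \<in> sets \<mu> \<Longrightarrow> skew \<Phi> R f -` A \<inter> space \<mu> = A \<Longrightarrow>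
    emeasure \<mu> A = 0 \<or> emeasure \<mu> A = 1"
  using \<mu> unfolding ergodic_measures_def by auto

lemma ergodic_space: "space \<mu> = Lambda \<Phi> R f"
  using sets_eq_imp_space_eq[OF ergodic_sets] by (simp add: space_restrict_space)

text \<open>The measurable sets are the traces of Borel sets on \<open>Lambda\<close>, so continuity
  on that subspace is enough.\<close>

lemma measurable_if_continuous_on_Lambda:
  fixes g :: "(real \<times> real) \<times> real \<Rightarrow> 'c::topological_space"
  assumes "continuous_on (Lambda \<Phi> R f) g"
  shows "g \<in> borel_measurable \<mu>"
  using borel_measurable_continuous_on_restrict[OF assms] measurable_cong_sets[OF ergodic_sets refl]
  by blast

lemma measurable_symbol: "(\<lambda>p. \<omega> (fst p) j) \<in> borel_measurable \<mu>"
proof (rule measurable_if_continuous_on_Lambda)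
  have "continuous_on \<Gamma> \<omega>"
    using horseshoe_conjugation unfolding homeomorphism_def by blast
  then have "continuous_on \<Gamma> (\<lambda>X. \<omega> X j)"
    by (rule continuous_on_product_then_coordinatewise)
  then show "continuous_on (Lambda \<Phi> R f) (\<lambda>p. \<omega> (fst p) j)"
    by (rule continuous_on_compose2) (use Lambda_in(1) in \<open>auto intro: continuous_on_fst\<close>)
qed

lemma symbol_sets: "{p \<in> space \<mu>. \<omega> (fst p) j = i} \<in> sets \<mu>"
  using measurable_sets[OF measurable_symbol[of j], of "{i}"]
  by (auto simp: vimage_def Int_def conj_commute)

text \<open>The potential is glued from three functions along measurable symbol cylinders; each is
  continuous because its derivative is continuous and never 0.\<close>

lemma measurable_phi: "\<phi> \<in> borel_measurable \<mu>"
proof -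
  have m: "(\<lambda>p. ln \<bar>fderiv (f i) (snd p)\<bar>) \<in> borel_measurable \<mu>" if i: "i \<in> {0, 1, 2}" for i
  proof (rule measurable_if_continuous_on_Lambda)
    have "continuous_on (Lambda \<Phi> R f) (\<lambda>p. fderiv (f i) (snd p))"
      by (rule continuous_on_compose2[OF continuous_on_fderiv[OF fibers i]])
        (use Lambda_in(2) in \<open>auto intro: continuous_on_snd\<close>)
    then show "continuous_on (Lambda \<Phi> R f) (\<lambda>p. ln \<bar>fderiv (f i) (snd p)\<bar>)"
      using fderiv_nonzero[OF i] Lambda_in(2)
      by (intro continuous_on_ln continuous_on_rabs) auto
  qed
  have "(\<lambda>p. if \<omega> (fst p) 0 = 0 then ln \<bar>fderiv (f 0) (snd p)\<bar> else
          if \<omega> (fst p) 0 = 1 then ln \<bar>fderiv (f 1) (snd p)\<bar> else ln \<bar>fderiv (f 2) (snd p)\<bar>)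
        \<in> borel_measurable \<mu>"
    by (intro measurable_If m symbol_sets) auto
  also have "?this \<longleftrightarrow> ?thesis"
    using symbol_in[OF Lambda_in(1), of _ 0]
    by (intro measurable_cong) (fastforce simp: \<phi>_def ergodic_space)
  finally show ?thesis .
qed

lemma central_exponent_eq: "central_exponent (skew \<Phi> R f) \<mu> = integral\<^sup>L \<mu> \<phi>"
  unfolding central_exponent_def
  by (rule Bochner_Integration.integral_cong[OF refl]) (use central_derivative ergodic_space in auto)

lemma phi_bounds:
  assumes "p \<in> space \<mu>"
  shows "ln a \<le> \<phi> p" "\<phi> p \<le> ln b"
  using ln_bounds[OF symbol_in] Lambda_in[of p] assms by (auto simp: \<phi>_def ergodic_space)

lemma integrable_phi: "integrable \<mu> \<phi>"
proof -
  interpret prob_space \<mu> by (rule ergodic_prob)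
  show ?thesis
    by (rule integrable_const_bound[where B = "\<bar>ln a\<bar> + \<bar>ln b\<bar>"])
      (use phi_bounds measurable_phi in \<open>fastforce intro: AE_I2\<close>)+
qed

lemma central_exponent_ge: "ln a \<le> central_exponent (skew \<Phi> R f) \<mu>"
proof -
  interpret prob_space \<mu> by (rule ergodic_prob)
  show ?thesis
    unfolding central_exponent_eq
    by (rule integral_ge_const[OF integrable_phi]) (use phi_bounds in \<open>auto intro: AE_I2\<close>)
qed

text \<open>The upper exponent of a point is the limsup of the Birkhoff averages of
  \<open>\<phi>\<close>. By assumption almost every point enters the supremum in
  \<open>beta_tilde\<close>, and \<open>integral_le_limsup_averages\<close> carries the bound over
  to the integral.\<close>

lemma central_exponent_le_beta_tilde:
  assumes "AE p in \<mu>. (snd p, \<omega> (fst p)) \<notin> exceptional"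
  shows "central_exponent (skew \<Phi> R f) \<mu> \<le> ln (beta_tilde f)"
proof -
  interpret prob_space \<mu> by (rule ergodic_prob)
  have lim: "AE p in \<mu>. limsup (\<lambda>n. ereal (1 / real n * (\<Sum>k<n. \<phi> ((skew \<Phi> R f ^^ k) p))))
          \<le> ereal (ln (beta_tilde f))"
    using assms AE_space
  proof eventually_elim
    case (elim p)
    then have p: "p \<in> Lambda \<Phi> R f" by (simp add: ergodic_space)
    show ?case using upper_exponent_le_beta_tilde[OF p elim(1)]
      unfolding upper_exponent_def log_derivative_averages[OF p] .
  qed
  have "\<bar>\<phi> p\<bar> \<le> \<bar>ln a\<bar> + \<bar>ln b\<bar>" if "p \<in> space \<mu>" for p
    using phi_bounds[OF that] by linarith
  from integral_le_limsup_averages[OF ergodic_measurable ergodic_distr measurable_phi this lim]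
  show ?thesis unfolding central_exponent_eq .
qed

section \<open>The exceptional set up to null sets, and the zero-one alternative\<close>

definition only_one_at :: "int \<Rightarrow> ((real \<times> real) \<times> real) set" where
  "only_one_at k = {p \<in> space \<mu>. \<forall>j. \<omega> (fst p) j = 1 \<longleftrightarrow> j = k}"

lemma only_one_at_sets: "only_one_at k \<in> sets \<mu>"
proof -
  have "{p \<in> space \<mu>. \<omega> (fst p) j = 1 \<longleftrightarrow> j = k} \<in> sets \<mu>" for j
    using symbol_sets[of j 1] sets.sets_Collect_neg[OF symbol_sets[of j 1]]
    by (cases "j = k") simp_all
  then show ?thesis unfolding only_one_at_def by (rule sets.sets_Collect_countable_All)
qed

text \<open>The dynamics moves the single symbol 1 by one place, which makes
  \<open>only_one_at\<close> a wandering family.\<close>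

lemma only_one_at_null: "emeasure \<mu> (only_one_at k) = 0"
proof -
  interpret prob_space \<mu> by (rule ergodic_prob)
  show ?thesis
  proof (rule wandering_null[OF ergodic_measurable ergodic_distr])
    show "only_one_at k \<in> sets \<mu>" for k by (rule only_one_at_sets)
    show "disjoint_family only_one_at"
      by (auto simp: disjoint_family_on_def only_one_at_def)
    \<comment> \<open>Symbol \<open>j\<close> of the image is symbol \<open>j + 1\<close> of the
      point, so taking the preimage raises the index.\<close>
    show "skew \<Phi> R f -` only_one_at k \<inter> space \<mu> = only_one_at (k + 1)" for k
    proof -
      have "(\<forall>j. \<omega> (fst (skew \<Phi> R f p)) j = 1 \<longleftrightarrow> j = k) \<longleftrightarrow>
            (\<forall>j. \<omega> (fst p) j = 1 \<longleftrightarrow> j = k + 1)" if "p \<in> space \<mu>" for p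
        using all_int_shift[of "\<lambda>j. \<omega> (fst p) j = 1 \<longleftrightarrow> j = k + 1"] that
        by (simp add: symbol_skew ergodic_space)
      then show ?thesis
        using measurable_space[OF ergodic_measurable] by (auto simp: only_one_at_def)
    qed
  qed
qed

text \<open>Symbols over \<open>Lambda\<close> lie in {0, 1, 2}, so a sequence without 1 is one over
  {0, 2}: these points give exceptional pairs of the first kind.\<close>

definition zero_fiber :: "((real \<times> real) \<times> real) set" where
  "zero_fiber = {p \<in> space \<mu>. snd p = 0 \<and> (\<forall>j. \<omega> (fst p) j \<noteq> 1)}"

lemma zero_fiber_sets: "zero_fiber \<in> sets \<mu>"
proof -
  have "(\<lambda>p. snd p :: real) \<in> borel_measurable \<mu>"
    by (rule measurable_if_continuous_on_Lambda) (intro continuous_intros)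
  then have "{p \<in> space \<mu>. snd p = 0} \<in> sets \<mu>" by measurable
  moreover have "{p \<in> space \<mu>. \<forall>j. \<omega> (fst p) j \<noteq> 1} \<in> sets \<mu>"
    by (intro sets.sets_Collect_countable_All sets.sets_Collect_neg symbol_sets)
  ultimately show ?thesis
    unfolding zero_fiber_def by (intro sets.sets_Collect_conj)
qed

text \<open>Without the symbol 1 only \<open>f 0\<close> or \<open>f 2\<close> is applied. Both fix
  0 and are injective, so the fiber coordinate is 0 after a step exactly if it was 0 before; a
  condition on all positions is unaffected by the shift.\<close>

lemma zero_fiber_invariant:
  assumes "f 0 0 = 0" "f 2 0 = 0"
  shows "skew \<Phi> R f -` zero_fiber \<inter> space \<mu> = zero_fiber"
proof -
  have "skew \<Phi> R f p \<in> zero_fiber \<longleftrightarrow> p \<in> zero_fiber" if p: "p \<in> space \<mu>" for p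
  proof -
    have L: "p \<in> Lambda \<Phi> R f" using p by (simp add: ergodic_space)
    have symb: "(\<forall>j. \<omega> (fst (skew \<Phi> R f p)) j \<noteq> 1) \<longleftrightarrow> (\<forall>j. \<omega> (fst p) j \<noteq> 1)"
      using all_int_shift[of "\<lambda>j. \<omega> (fst p) j \<noteq> 1"] by (simp add: symbol_skew[OF L])
    have "f (\<omega> (fst p) 0) (snd p) = 0 \<longleftrightarrow> snd p = 0" if "\<omega> (fst p) 0 \<noteq> 1"
    proof -
      let ?i = "\<omega> (fst p) 0"
      have "?i = 0 \<or> ?i = 2" using symbol_in[OF Lambda_in(1)[OF L], of 0] that by auto
      then have "f ?i 0 = 0" "inj_on (f ?i) {0..1}"
        using assms fibers unfolding fiber_maps_def by auto
      then show ?thesis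
        using Lambda_in(2)[OF L] inj_onD[of "f ?i" "{0..1}" "snd p" 0] by auto
    qed
    moreover have "snd (skew \<Phi> R f p) = f (\<omega> (fst p) 0) (snd p)"
      using skew_on_Gamma[OF Lambda_in(1)[OF L], of "snd p"] by simp
    moreover have "skew \<Phi> R f p \<in> space \<mu>" using measurable_space[OF ergodic_measurable p] .
    ultimately show ?thesis using symb p unfolding zero_fiber_def by auto
  qed
  moreover have "zero_fiber \<subseteq> space \<mu>" by (auto simp: zero_fiber_def)
  ultimately show ?thesis by blast
qed

text \<open>Exceptional pairs of the second and third kind carry exactly one symbol 1, at position
  \<open>k\<close> or \<open>-k - 1\<close>. Their points lie in countably many null sets
  \<open>only_one_at\<close>.\<close>

lemma exceptional_AE_zero_fiber:
  "AE p in \<mu>. (snd p, \<omega> (fst p)) \<in> exceptional \<longrightarrow> p \<in> zero_fiber"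
proof -
  have "AE p in \<mu>. \<forall>k. p \<notin> only_one_at k"
  proof (subst AE_all_countable, intro allI)
    fix k
    have "only_one_at k \<in> null_sets \<mu>"
      using only_one_at_null only_one_at_sets by (simp add: null_sets_def)
    then show "AE p in \<mu>. p \<notin> only_one_at k" by (rule AE_not_in)
  qed
  then show ?thesis
    using AE_space
  proof eventually_elim
    case (elim p)
    have "p \<in> only_one_at k" if "\<omega> (fst p) k = 1" "\<And>j. j \<noteq> k \<Longrightarrow> \<omega> (fst p) j \<in> {0, 2}" for k
      using that elim(2) by (force simp: only_one_at_def)
    then have no: "\<not> (\<omega> (fst p) k = 1 \<and> (\<forall>j. j \<noteq> k \<longrightarrow> \<omega> (fst p) j \<in> {0, 2}))" for k
      using elim(1) by blast
    show ?case
    proof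
      assume "(snd p, \<omega> (fst p)) \<in> exceptional"
      then consider "snd p = 0" "\<forall>j. \<omega> (fst p) j \<in> {0, 2}"
        | k :: nat where "\<forall>j < int k. \<omega> (fst p) j = 0" "\<omega> (fst p) (int k) = 1"
            "\<forall>j > int k. \<omega> (fst p) j \<in> {0, 2}"
        | k :: nat where "\<forall>j < - int k - 1. \<omega> (fst p) j = 0" "\<omega> (fst p) (- int k - 1) = 1"
            "\<forall>j \<ge> - int k. \<omega> (fst p) j \<in> {0, 2}"
        unfolding exceptional_def by blast
      then show "p \<in> zero_fiber"
      proof cases
        case 1
        have "\<omega> (fst p) j \<noteq> 1" for j
        proof -
          have "\<omega> (fst p) j \<in> {0, 2}" using 1(2) by (rule spec)
          then show ?thesis by auto
        qed
        then show ?thesis using 1 elim(2) by (simp add: zero_fiber_def)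
      next
        case 2
        then have "\<forall>j. j \<noteq> int k \<longrightarrow> \<omega> (fst p) j \<in> {0, 2}"
          by (metis insertI1 linorder_neqE)
        then show ?thesis using no 2 by blast
      next
        case 3
        have "\<omega> (fst p) j \<in> {0, 2}" if "j \<noteq> - int k - 1" for j
          using 3 that by (cases "j < - int k - 1") auto
        then show ?thesis using no 3 by blast
      qed
    qed
  qed
qed

lemma central_exponent_dichotomy:
  assumes "f 0 0 = 0" "f 2 0 = 0"
  shows "central_exponent (skew \<Phi> R f) \<mu> \<le> ln (beta_tilde f) \<or>
    central_exponent (skew \<Phi> R f) \<mu> \<in>
      {min (ln \<bar>fderiv (f 0) 0\<bar>) (ln \<bar>fderiv (f 2) 0\<bar>)..max (ln \<bar>fderiv (f 0) 0\<bar>) (ln \<bar>fderiv (f 2) 0\<bar>)}"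
proof -
  interpret prob_space \<mu> by (rule ergodic_prob)
  consider "emeasure \<mu> zero_fiber = 0" | "emeasure \<mu> zero_fiber = 1"
    using ergodic_01[OF zero_fiber_sets zero_fiber_invariant[OF assms]] by blast
  then show ?thesis
  proof cases
    case 1
    then have "AE p in \<mu>. p \<notin> zero_fiber"
      using zero_fiber_sets by (intro AE_not_in) (simp add: null_sets_def)
    with exceptional_AE_zero_fiber have "AE p in \<mu>. (snd p, \<omega> (fst p)) \<notin> exceptional"
      by eventually_elim blast
    then show ?thesis using central_exponent_le_beta_tilde by blast
  next
    case 2
    then have "AE p in \<mu>. p \<in> zero_fiber"
      using zero_fiber_sets by (intro AE_prob_1) (simp add: emeasure_eq_measure)
    \<comment> \<open>The fiber coordinate is 0 and the symbol is 0 or 2, so \<open>\<phi>\<close>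
      takes two values almost everywhere. Which one is larger is not fixed, hence the minimum and
      maximum.\<close>
    then have ae: "AE p in \<mu>. \<phi> p = ln \<bar>fderiv (f 0) 0\<bar> \<or> \<phi> p = ln \<bar>fderiv (f 2) 0\<bar>"
      using AE_space
    proof eventually_elim
      case (elim p)
      then show ?case
        using symbol_in[OF Lambda_in(1), of p 0]
        by (auto simp: zero_fiber_def \<phi>_def ergodic_space)
    qed
    have "min (ln \<bar>fderiv (f 0) 0\<bar>) (ln \<bar>fderiv (f 2) 0\<bar>) \<le> integral\<^sup>L \<mu> \<phi>"
      by (rule integral_ge_const[OF integrable_phi]) (use ae in \<open>auto elim: eventually_mono\<close>)
    moreover have "integral\<^sup>L \<mu> \<phi> \<le> max (ln \<bar>fderiv (f 0) 0\<bar>) (ln \<bar>fderiv (f 2) 0\<bar>)"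
      by (rule integral_le_const[OF integrable_phi]) (use ae in \<open>auto elim: eventually_mono\<close>)
    ultimately show ?thesis by (simp add: central_exponent_eq)
  qed
qed

end

end

section \<open>The spectrum in terms of the constants of the fiber maps\<close>

theorem corollary5p1:
  fixes \<Phi> :: "real \<times> real \<Rightarrow> real \<times> real"
    and \<Gamma> :: "(real \<times> real) set"
    and \<omega> :: "real \<times> real \<Rightarrow> int \<Rightarrow> nat"
    and R :: "nat \<Rightarrow> (real \<times> real) set"
    and s u :: "nat \<Rightarrow> real"
    and f :: "nat \<Rightarrow> real \<Rightarrow> real"
    and \<gamma> :: real
  assumes base: "three_legged_horseshoe \<Phi> \<Gamma> \<omega> R s u"
    and fibers: "fiber_maps f"
    and domination: "dominated_rates s u f"
    and F0: "F0 f"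
    and F1: "F1 f \<gamma>"
    and F2: "F2 f"
    and F01: "F01 f \<gamma>"
    and F012: "F012 f \<gamma>"
    and f2_contraction: "\<forall>x\<in>{0..1}. lam0 f \<le> fderiv (f 2) x"
  shows "{central_exponent (skew \<Phi> R f) \<mu> | \<mu>. \<mu> \<in> ergodic_measures (skew \<Phi> R f) (Lambda \<Phi> R f)}
           \<subseteq> {ln (lam0 f)..ln (beta_tilde f)} \<union> {ln (beta02_minus f)..ln (beta02_plus f)}"
proof -
  \<comment> \<open>The affine map reverses orientation; its absolute derivative is constantly
    \<open>\<gamma>\<close>.\<close>
  have f1: "fderiv (f 1) x = - \<gamma>" if x: "x \<in> {0..1}" for x
  proof (rule fderiv_eqI[OF _ x])
    have "((\<lambda>x. \<gamma> * (1 - x)) has_real_derivative - \<gamma>) (at x within {0..1})"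
      by (auto intro!: derivative_eq_intros)
    then show "(f 1 has_real_derivative - \<gamma>) (at x within {0..1})"
      using F1 x unfolding F1_def
      \<comment> \<open>The two functions agree on the whole interval, so any positive radius would
        do.\<close>
      by (elim has_field_derivative_transform_within[where d = 1]) auto
  qed
  have pos: "0 < lam0 f" and betas: "1 < beta0 f" "1 < beta2 f" and gam: "lam0 f \<le> \<gamma>" "\<gamma> < 1"
    using F0 F1 F2 unfolding F0_def F1_def F2_def by auto
  have zeros: "f 0 0 = 0" "f 2 0 = 0" using F0 F2 unfolding F0_def F2_def by auto
  have d0: "lam0 f \<le> fderiv (f 0) x" "fderiv (f 0) x \<le> beta02_plus f"
    and d2: "lam0 f \<le> fderiv (f 2) x" "fderiv (f 2) x \<le> beta02_plus f" if "x \<in> {0..1}" for x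
    using F0 F012 f2_contraction that unfolding F0_def F012_def by auto
  \<comment> \<open>With \<open>lam0 f \<le> \<gamma>\<close> and \<open>\<gamma> < 1\<close>, this
    puts the absolute derivative of \<open>f 1\<close> between the two bounds as well.\<close>
  have "1 < beta02_plus f" using betas by (simp add: beta02_plus_def)
  then interpret horseshoe_skew_product \<Phi> \<Gamma> \<omega> R s u f "lam0 f" "beta02_plus f"
    using base fibers pos f1 gam d0 d2 by unfold_locales force+
  \<comment> \<open>The derivatives at 0 are \<open>beta0 f\<close> and \<open>beta2 f\<close>. Both
    exceed 1, so the absolute values disappear and the monotone logarithm commutes with minimum and
    maximum.\<close>
  have "min (ln \<bar>fderiv (f 0) 0\<bar>) (ln \<bar>fderiv (f 2) 0\<bar>) = ln (beta02_minus f)"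
    and "max (ln \<bar>fderiv (f 0) 0\<bar>) (ln \<bar>fderiv (f 2) 0\<bar>) = ln (beta02_plus f)"
    using betas by (auto simp: beta02_minus_def beta02_plus_def beta0_def beta2_def min_def max_def)
  then show ?thesis
    using central_exponent_dichotomy[OF _ zeros] central_exponent_ge by fastforce
qed

end
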